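(* Let $r\in(0,+\infty]$ and let $b>a>0$ be real numbers. Then $$L_r(a,b)+L_{-r}(a,b)>2L_0(a,b),$$ where $L_r(a,b)$ denotes the generalized logarithmic mean of $a$ and $b$.
   Context: For positive real numbers $a\neq b$ and real $r\notin\{0,1\}$, the generalized logarithmic mean is $$L_r(a,b)=\Big(\frac{b^r-a^r}{r(b-a)}\Big)^{\frac{1}{r-1}},$$ and the remaining values for $r\in[-\infty,+\infty]$ are defined as limits: $L_0(a,b)=\frac{b-a}{\ln b-\ln a}$, $L_1(a,b)=\frac1e\Big(\frac{b^b}{a^a}\Big)^{\frac{1}{b-a}}$, $L_{-\infty}(a,b)=\min(a,b)$, $L_{+\infty}(a,b)=\max(a,b)$. *)

theory Defs
  imports "HOL-Library.Extended_Real"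
begin

text \<open>The mean of order \<open>r \<in> [-\<infinity>, +\<infinity>]\<close>; meaningful for \<open>a, b > 0\<close> with \<open>a \<noteq> b\<close> only
  (the formulas divide by \<open>b - a\<close>). The orders \<open>0\<close>, \<open>1\<close>, \<open>-\<infinity>\<close>, \<open>+\<infinity>\<close>, at which the general
  formula is undefined, carry the closed forms of its limits.\<close>

definition gen_log_mean_real :: "real \<Rightarrow> real \<Rightarrow> real \<Rightarrow> real" where
  "gen_log_mean_real r a b =
    (if r = 0 then (b - a) / (ln b - ln a)
     else if r = 1 then 1 / exp 1 * (b powr b / a powr a) powr (1 / (b - a))
     else ((b powr r - a powr r) / (r * (b - a))) powr (1 / (r - 1)))"

definition gen_log_mean :: "ereal \<Rightarrow> real \<Rightarrow> real \<Rightarrow> real" where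
  "gen_log_mean r a b =
    (if r = \<infinity> then max a b
     else if r = -\<infinity> then min a b
     else gen_log_mean_real (real_of_ereal r) a b)"

end

theory Submission
  imports Defs
begin

text \<open>
  Write \<open>a = exp (c - t)\<close>, \<open>b = exp (c + t)\<close>, \<open>\<phi> x = ln (sinh x / x)\<close> and
  \<open>m = (\<phi> (r t) - \<phi> t) / (r\<^sup>2 - 1)\<close>. The means of order \<open>r\<close>, \<open>-r\<close> and \<open>0\<close> are
  \<open>exp (c + m + r m)\<close>, \<open>exp (c + m - r m)\<close> and \<open>exp (c + \<phi> t)\<close>, so the claim is
  \<open>\<phi> t < m + ln (cosh (r m))\<close>. For \<open>r < 1\<close> both sides vanish as \<open>t\<close> tends to \<open>0\<close>, and the
  difference of their derivatives in \<open>t\<close> is positive because the Langevin function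
  \<open>\<phi>' x = coth x - 1 / x\<close> is strictly concave: concavity bounds \<open>m\<close> from below by the trapezoidal
  rule, and after \<open>exp u \<ge> 1 + u\<close> the remaining inequality is concavity once more. Concavity itself
  amounts to \<open>sinh x ^ 3 > x ^ 3 * cosh x\<close>. The case \<open>r > 1\<close> follows since the claim is invariant
  under \<open>(r, t) \<mapsto> (1 / r, r t)\<close>, and \<open>r = 1\<close> is the same argument with
  \<open>m = t \<phi>' t / 2\<close>.
\<close>

definition langevin :: "real \<Rightarrow> real" where
  "langevin x = cosh x / sinh x - 1 / x"

definition langevin' :: "real \<Rightarrow> real" where
  "langevin' x = 1 / x\<^sup>2 - 1 / (sinh x)\<^sup>2"

definition ln_sinhc :: "real \<Rightarrow> real" where
  "ln_sinhc x = ln (sinh x / x)"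

section \<open>Monotonicity from derivatives on an open half-line\<close>

lemma DERIV_pos_imp_increasing_from:
  fixes f :: "real \<Rightarrow> real"
  assumes "\<And>x. x > a \<Longrightarrow> (f has_real_derivative f' x) (at x)"
    and "\<And>x. x > a \<Longrightarrow> f' x > 0" and "a < x" and "x < y"
  shows "f x < f y"
proof (rule DERIV_pos_imp_increasing[OF \<open>x < y\<close>])
  fix u assume "x \<le> u"
  then show "\<exists>d. (f has_real_derivative d) (at u) \<and> 0 < d"
    using assms by (intro exI[of _ "f' u"]) auto
qed

text \<open>A one-sided limit replaces the value at \<open>0\<close>, where quotients such as
  \<open>sinh x / x\<close> degenerate.\<close>

lemma pos_if_tendsto_0_at_right:
  fixes f :: "real \<Rightarrow> real"
  assumes deriv: "\<And>x. x > 0 \<Longrightarrow> (f has_real_derivative f' x) (at x)"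
    and pos: "\<And>x. x > 0 \<Longrightarrow> f' x > 0"
    and lim: "(f \<longlongrightarrow> 0) (at_right 0)"
    and "x > 0"
  shows "f x > 0"
proof -
  have less: "f u < f v" if "0 < u" "u < v" for u v
    by (rule DERIV_pos_imp_increasing_from[OF deriv pos that])
  \<comment> \<open>The limit yields only a weak inequality; comparing at \<open>x / 2\<close>
    leaves room for a strict one at \<open>x\<close>.\<close>
  have "eventually (\<lambda>y. f y \<le> f (x / 2)) (at_right 0)"
    unfolding eventually_at_right_field
    by (rule exI[of _ "x / 2"]) (use \<open>x > 0\<close> less in \<open>auto intro: less_imp_le\<close>)
  then have "0 \<le> f (x / 2)"
    by (intro tendsto_upperbound[OF lim]) auto
  also have "\<dots> < f x"
    using \<open>x > 0\<close> by (intro less) auto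
  finally show ?thesis .
qed

section \<open>Inequalities for hyperbolic functions\<close>

lemma sinh_gt_self:
  fixes x :: real
  assumes "x > 0"
  shows "sinh x > x"
proof -
  have "sinh 0 - 0 < sinh x - x"
  proof (rule DERIV_pos_imp_increasing_open[OF assms])
    fix u :: real assume "0 < u"
    then show "\<exists>y. ((\<lambda>x. sinh x - x) has_real_derivative y) (at u) \<and> 0 < y"
      using cosh_real_strict_mono[of 0 u]
      by (intro exI[of _ "cosh u - 1"]) (auto intro!: derivative_eq_intros)
  qed (auto intro!: continuous_intros)
  then show ?thesis by simp
qed

text \<open>Taking cube roots isolates \<open>x\<close>, so one differentiation suffices: in terms
  of \<open>c\<close>, the cube root of \<open>cosh u\<close>, the derivative of the difference is a
  rational function whose numerator contains the square of \<open>c\<^sup>2 - 1\<close>.\<close>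

lemma sinh_cubed_gt:
  fixes x :: real
  assumes "x > 0"
  shows "sinh x ^ 3 > x ^ 3 * cosh x"
proof -
  define f where "f = (\<lambda>x::real. sinh x * cosh x powr (- (1 / 3)) - x)"
  have "f 0 < f x"
  proof (rule DERIV_pos_imp_increasing_open[OF assms])
    fix u :: real assume u: "0 < u"
    define c where "c = cosh u powr (1 / 3)"
    have c3: "cosh u = c ^ 3"
      by (simp add: c_def powr_power)
    have c1: "c > 1"
      using cosh_real_strict_mono[of 0 u] u by (simp add: c_def gr_one_powr)
    have inv: "cosh u powr (- (1 / 3)) = 1 / c"
      by (simp add: c_def powr_minus field_simps)
    have inv4: "cosh u powr (- (4 / 3)) = 1 / c ^ 4"
    proof -
      have "c ^ 4 = cosh u powr (4 / 3)"
        by (simp add: c_def powr_power)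
      then show ?thesis
        using powr_minus_divide[of "cosh u" "4 / 3"] by simp
    qed
    have s2: "sinh u * sinh u = c ^ 6 - 1"
      using cosh_square_eq[of u] by (simp add: c3 power2_eq_square flip: power_add)
    have "(f has_real_derivative
        cosh u * (1 / c) - sinh u * sinh u * ((1 / 3) * (1 / c ^ 4)) - 1) (at u)"
      unfolding f_def
      by (auto intro!: derivative_eq_intros simp: inv inv4)
    moreover have "cosh u * (1 / c) - sinh u * sinh u * ((1 / 3) * (1 / c ^ 4)) - 1
        = (c\<^sup>2 - 1)\<^sup>2 * (2 * c\<^sup>2 + 1) / (3 * c ^ 4)"
      using c1 unfolding s2 c3 by (simp add: field_simps eval_nat_numeral)
    moreover have "c\<^sup>2 > 1"
      using c1 by (simp add: one_less_power)
    then have "(c\<^sup>2 - 1)\<^sup>2 > 0" "2 * c\<^sup>2 + 1 > 0"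
      by (intro zero_less_power, linarith, linarith)
    then have "(c\<^sup>2 - 1)\<^sup>2 * (2 * c\<^sup>2 + 1) / (3 * c ^ 4) > 0"
      using c1 by (intro divide_pos_pos mult_pos_pos) auto
    ultimately show "\<exists>y. (f has_real_derivative y) (at u) \<and> 0 < y"
      by auto
  qed (auto simp: f_def intro!: continuous_intros)
  then have "x < sinh x * cosh x powr (- (1 / 3))"
    by (simp add: f_def)
  then have "x ^ 3 < (sinh x * cosh x powr (- (1 / 3))) ^ 3"
    using assms by (intro power_strict_mono) auto
  also have "\<dots> = sinh x ^ 3 / cosh x"
    by (simp add: power_mult_distrib powr_power powr_minus field_simps)
  finally show ?thesis
    by (simp add: field_simps)
qed

section \<open>Monotonicity and concavity of the Langevin function\<close>

lemma has_real_derivative_ln_sinhc: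
  assumes "x > 0"
  shows "(ln_sinhc has_real_derivative langevin x) (at x)"
proof -
  have "((\<lambda>x. ln (sinh x / x)) has_real_derivative langevin x) (at x)"
    using assms unfolding langevin_def
    by (auto intro!: derivative_eq_intros simp: field_simps power2_eq_square)
  then show ?thesis
    unfolding ln_sinhc_def[abs_def] .
qed

lemma has_real_derivative_langevin:
  assumes "x > 0"
  shows "(langevin has_real_derivative langevin' x) (at x)"
proof -
  have "((\<lambda>x. cosh x / sinh x - 1 / x) has_real_derivative
      (sinh x * sinh x - cosh x * cosh x) / (sinh x * sinh x) + 1 / (x * x)) (at x)"
    using assms by (auto intro!: derivative_eq_intros)
  also have "sinh x * sinh x - cosh x * cosh x = -1"
    using cosh_square_eq[of x] by (simp add: power2_eq_square)
  finally show ?thesis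
    unfolding langevin_def[abs_def] langevin'_def by (simp add: power2_eq_square)
qed

lemma langevin'_pos:
  assumes "x > 0"
  shows "langevin' x > 0"
proof -
  have "x\<^sup>2 < (sinh x)\<^sup>2"
    using sinh_gt_self[OF assms] assms by (intro power_strict_mono) auto
  then show ?thesis
    using assms by (simp add: langevin'_def field_simps)
qed

lemma langevin'_strict_antimono:
  assumes "0 < x" and "x < y"
  shows "langevin' y < langevin' x"
proof -
  have "- langevin' x < - langevin' y"
  proof (rule DERIV_pos_imp_increasing_from[OF _ _ assms])
    fix u :: real assume u: "u > 0"
    show "((\<lambda>x. - langevin' x) has_real_derivative
        2 / u ^ 3 - 2 * cosh u / sinh u ^ 3) (at u)"
      unfolding langevin'_def[abs_def] using u
      by (auto intro!: derivative_eq_intros simp: field_simps eval_nat_numeral)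
    show "2 / u ^ 3 - 2 * cosh u / sinh u ^ 3 > 0"
      using sinh_cubed_gt[OF u] u by (simp add: field_simps)
  qed
  then show ?thesis by simp
qed

lemma langevin_strict_mono:
  assumes "0 < x" and "x < y"
  shows "langevin x < langevin y"
  by (rule DERIV_pos_imp_increasing_from[OF has_real_derivative_langevin langevin'_pos assms])

text \<open>After multiplication by \<open>x * sinh x\<close> this is
  \<open>sinh x < x * cosh x\<close>, where the difference has derivative
  \<open>x * sinh x\<close>.\<close>

lemma langevin_pos:
  assumes "x > 0"
  shows "langevin x > 0"
proof -
  have "0 * cosh 0 - sinh 0 < x * cosh x - sinh x"
  proof (rule DERIV_pos_imp_increasing_open[OF assms])
    fix u :: real assume "0 < u"
    then show "\<exists>y. ((\<lambda>x. x * cosh x - sinh x) has_real_derivative y) (at u) \<and> 0 < y"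
      by (intro exI[of _ "u * sinh u"]) (auto intro!: derivative_eq_intros)
  qed (auto intro!: continuous_intros)
  then show ?thesis
    using assms by (simp add: langevin_def field_simps)
qed

section \<open>The trapezoidal bound and the inequality for \<open>tanh\<close>\<close>

lemma ln_sinhc_trapezoid:
  assumes "0 < s" and "s < t"
  shows "(t - s) * (langevin s + langevin t) / 2 < ln_sinhc t - ln_sinhc s"
proof -
  \<comment> \<open>The error of the trapezoidal rule as a function of the upper endpoint. Its
    derivative is half of \<open>langevin u - langevin s - (u - s) * langevin' u\<close>, which
    concavity makes positive.\<close>
  define f where "f = (\<lambda>x. ln_sinhc x - ln_sinhc s - (x - s) * (langevin s + langevin x) / 2)"
  have deriv: "(f has_real_derivative
      langevin u - ((langevin s + langevin u) + (u - s) * langevin' u) / 2) (at u)" if "u > 0" for u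
    unfolding f_def using that
    by (auto intro!: derivative_eq_intros has_real_derivative_ln_sinhc has_real_derivative_langevin)
  have "f s < f t"
  proof (rule DERIV_pos_imp_increasing_open[OF \<open>s < t\<close>])
    fix u assume u: "s < u"
    obtain \<xi> where \<xi>: "s < \<xi>" "\<xi> < u" "langevin u - langevin s = (u - s) * langevin' \<xi>"
      using MVT2[OF u, of langevin langevin'] \<open>0 < s\<close> has_real_derivative_langevin by auto
    have "(u - s) * langevin' u < (u - s) * langevin' \<xi>"
      using \<xi> u \<open>0 < s\<close> langevin'_strict_antimono[of \<xi> u] by (intro mult_strict_left_mono) auto
    then have "langevin u - ((langevin s + langevin u) + (u - s) * langevin' u) / 2 > 0"
      using \<xi>(3) by (simp add: field_simps)
    then show "\<exists>y. (f has_real_derivative y) (at u) \<and> 0 < y"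
      using deriv[of u] u \<open>0 < s\<close> by auto
  next
    show "continuous_on {s..t} f"
      by (rule DERIV_continuous_on, rule has_field_derivative_at_within, rule deriv) (use \<open>0 < s\<close> in auto)
  qed
  then show ?thesis by (simp add: f_def)
qed

text \<open>Writing \<open>tanh z\<close> through \<open>exp (2 * z)\<close> and clearing the
  denominator gives a condition linear in \<open>exp (2 * z)\<close>, ready for
  \<open>exp u \<ge> 1 + u\<close>.\<close>

lemma tanh_real_gt_divide:
  fixes z :: real
  assumes "X > 0" and "exp (2 * z) * (X - Y) > X + Y"
  shows "tanh z * X > Y"
proof -
  have "tanh z = (exp (2 * z) - 1) / (exp (2 * z) + 1)"
  proof -
    define w where "w = exp (2 * z)"
    have "tanh z = (1 - 1 / w) / (1 + 1 / w)"
      by (simp add: tanh_real_altdef w_def exp_minus divide_inverse)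
    moreover have "w > 0"
      by (simp add: w_def)
    moreover from this have "1 - 1 / w = (w - 1) / w" "1 + 1 / w = (w + 1) / w"
      by (simp_all add: field_simps)
    ultimately have "tanh z = (w - 1) / (w + 1)"
      by simp
    then show ?thesis
      by (simp add: w_def)
  qed
  then have "tanh z * X = (exp (2 * z) - 1) * X / (exp (2 * z) + 1)"
    by simp
  also have "\<dots> > Y"
    using assms by (subst pos_less_divide_eq) (simp_all add: add_pos_pos algebra_simps)
  finally show ?thesis .
qed

text \<open>With \<open>exp u \<ge> 1 + u\<close> the terms linear in \<open>coth\<close> cancel, and what is left is that
  \<open>langevin'\<close> decreases.\<close>

lemma langevin_tanh_ineq:
  assumes "0 < s" and "s < t"
    and z: "z \<ge> s * t * (langevin s + langevin t) / (2 * (s + t))"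
  shows "tanh z * (t * langevin t - s * langevin s) > t * langevin s - s * langevin t"
proof (rule tanh_real_gt_divide)
  define p q where "p = langevin s" and "q = langevin t"
  have pq: "0 < p" "p < q"
    using langevin_pos langevin_strict_mono assms by (auto simp: p_def q_def)
  then have "s * p < t * q"
    using assms by (intro mult_strict_mono) auto
  then show "t * langevin t - s * langevin s > 0"
    by (simp add: p_def q_def)
  define P Q where "P = cosh s / sinh s" and "Q = cosh t / sinh t"
  have p: "p = P - 1 / s" and q: "q = Q - 1 / t"
    by (simp_all add: p_def q_def P_def Q_def langevin_def)
  have coth2: "(cosh x / sinh x)\<^sup>2 = 1 + 1 / (sinh x)\<^sup>2" if "x > 0" for x :: real
    using that by (simp add: power_divide cosh_square_eq add_divide_distrib)
  \<comment> \<open>The two sides are \<open>1 - langevin' s\<close> and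
    \<open>1 - langevin' t\<close>.\<close>
  have "P\<^sup>2 - 1 / s\<^sup>2 < Q\<^sup>2 - 1 / t\<^sup>2"
    using langevin'_strict_antimono[OF assms(1,2)] assms(1,2)
    by (simp add: P_def Q_def coth2 langevin'_def)
  then have *: "s * t * (Q\<^sup>2 - 1 / t\<^sup>2 - (P\<^sup>2 - 1 / s\<^sup>2)) > 0"
    using assms by simp
  \<comment> \<open>For \<open>X = t * q - s * p\<close> and \<open>Y = t * p - s * q\<close>, the
    factors \<open>(t + s) * (q - p)\<close> and \<open>(t - s) * (p + q)\<close> are
    \<open>X - Y\<close> and \<open>X + Y\<close>.\<close>
  have "(1 + s * t * (p + q) / (s + t)) * ((t + s) * (q - p)) - (t - s) * (p + q)
      = s * t * (Q\<^sup>2 - 1 / t\<^sup>2 - (P\<^sup>2 - 1 / s\<^sup>2))"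
  proof -
    have "1 + s * t * (p + q) / (s + t) = s * t * (P + Q) / (s + t)"
    proof -
      have "s * t * (p + q) = s * t * (P + Q) - (s + t)"
        using assms(1,2) by (simp add: p q field_simps)
      then show ?thesis
        using assms(1,2) by (simp add: diff_divide_distrib)
    qed
    then have "(1 + s * t * (p + q) / (s + t)) * ((t + s) * (q - p)) = s * t * (P + Q) * (q - p)"
      using assms(1,2) by (simp add: add.commute[of t s])
    moreover have "s * (1 / s) = 1" "t * (1 / t) = 1"
      using assms(1,2) by simp_all
    then have "s * t * (P + Q) * (q - p) - (t - s) * (p + q)
        = s * t * (Q\<^sup>2 - (1 / t)\<^sup>2 - (P\<^sup>2 - (1 / s)\<^sup>2))"
      unfolding p q by algebra
    ultimately show ?thesis
      by (simp only: power_one_over)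
  qed
  with * have "(t - s) * (p + q) < (1 + s * t * (p + q) / (s + t)) * ((t + s) * (q - p))"
    by linarith
  also have exp_ge: "1 + u \<le> exp (2 * z)" if "u / 2 \<le> z" for u
    using exp_ge_add_one_self[of "2 * z"] that by linarith
  have "s * t * (p + q) / (s + t) / 2 \<le> z"
    using z unfolding p_def q_def divide_divide_eq_left mult.commute[of "s + t" 2] .
  then have "1 + s * t * (p + q) / (s + t) \<le> exp (2 * z)"
    by (rule exp_ge)
  then have "(1 + s * t * (p + q) / (s + t)) * ((t + s) * (q - p)) \<le> exp (2 * z) * ((t + s) * (q - p))"
    using pq assms(1,2) by (intro mult_right_mono) auto
  finally show "exp (2 * z) * (t * langevin t - s * langevin s - (t * langevin s - s * langevin t))
      > t * langevin t - s * langevin s + (t * langevin s - s * langevin t)"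
    by (simp add: p_def q_def algebra_simps)
qed

section \<open>The inequality for \<open>ln_sinhc\<close>\<close>

lemma has_real_derivative_ln_cosh:
  fixes x :: real
  shows "((\<lambda>x. ln (cosh x)) has_real_derivative tanh x) (at x)"
  by (auto intro!: derivative_eq_intros simp: tanh_def)

lemma sinhc_tendsto: "((\<lambda>x::real. sinh x / x) \<longlongrightarrow> 1) (at_right 0)"
proof -
  have "(sinh has_real_derivative 1) (at (0::real))"
    by (auto intro!: derivative_eq_intros)
  then have "((\<lambda>x::real. sinh x / x) \<longlongrightarrow> 1) (at 0)"
    by (simp add: DERIV_def)
  then show ?thesis
    by (rule tendsto_within_subset) simp
qed

lemma ln_sinhc_tendsto: "(ln_sinhc \<longlongrightarrow> 0) (at_right 0)"
  unfolding ln_sinhc_def[abs_def] using tendsto_ln[OF sinhc_tendsto] by simp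

text \<open>The derivative inequality is \<open>langevin_tanh_ineq\<close> at
  \<open>s = r * x\<close>, \<open>t = x\<close>, \<open>z = r * m x\<close>; the trapezoidal bound
  supplies its hypothesis on \<open>z\<close>.\<close>

lemma ln_sinhc_less_lt1:
  assumes r: "0 < r" "r < 1" and "t > 0"
  defines "m \<equiv> \<lambda>t. (ln_sinhc t - ln_sinhc (r * t)) / (1 - r\<^sup>2)"
  shows "ln_sinhc t < m t + ln (cosh (r * m t))"
proof -
  have r2: "1 - r\<^sup>2 > 0"
    using r by (simp add: power_less_one_iff)
  define m' where "m' = (\<lambda>t. (langevin t - r * langevin (r * t)) / (1 - r\<^sup>2))"
  have m: "(m has_real_derivative m' x) (at x)" if "x > 0" for x
  proof -
    have "((\<lambda>x. ln_sinhc (r * x)) has_real_derivative langevin (r * x) * r) (at x)"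
      using that r by (intro DERIV_chain2[OF has_real_derivative_ln_sinhc])
        (auto intro!: derivative_eq_intros)
    then show ?thesis
      unfolding m_def m'_def using that r2
      by (auto intro!: derivative_eq_intros has_real_derivative_ln_sinhc)
  qed
  have "0 < m t + ln (cosh (r * m t)) - ln_sinhc t"
  proof (rule pos_if_tendsto_0_at_right[OF _ _ _ \<open>t > 0\<close>])
    fix x :: real assume x: "x > 0"
    define \<tau> where "\<tau> = tanh (r * m x)"
    show "((\<lambda>t. m t + ln (cosh (r * m t)) - ln_sinhc t) has_real_derivative
        m' x + tanh (r * m x) * (r * m' x) - langevin x) (at x)"
      using x by (intro derivative_intros m has_real_derivative_ln_sinhc
          DERIV_chain2[OF has_real_derivative_ln_cosh] DERIV_cmult)
    have s: "0 < r * x" "r * x < x"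
      using r x by auto
    \<comment> \<open>The threshold for \<open>z\<close> is \<open>r / (1 - r\<^sup>2)\<close> times
      the trapezoidal sum over \<open>[r * x, x]\<close>: the factor \<open>1 - r\<close>
      cancels.\<close>
    have "r * x * x * (langevin (r * x) + langevin x) / (2 * (r * x + x))
        = r * ((x - r * x) * (langevin (r * x) + langevin x) / 2) / (1 - r\<^sup>2)"
    proof -
      have *: "r * x * x * A / (2 * (x * e)) = r * (x * d * A / 2) / (d * e)"
        if "d \<noteq> 0" "e \<noteq> 0" for A d e :: real
        using that x by (simp add: field_simps)
      have "1 - r\<^sup>2 = (1 - r) * (1 + r)" "r * x + x = x * (1 + r)" "x - r * x = x * (1 - r)"
        by (simp_all add: algebra_simps power2_eq_square)
      then show ?thesis
        using *[of "1 - r" "1 + r"] r by simp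
    qed
    also have "\<dots> \<le> r * m x"
    proof -
      have "(x - r * x) * (langevin (r * x) + langevin x) / 2 \<le> ln_sinhc x - ln_sinhc (r * x)"
        using ln_sinhc_trapezoid[OF s] by simp
      then show ?thesis
        unfolding m_def times_divide_eq_right using r r2
        by (intro divide_right_mono mult_left_mono) auto
    qed
    finally have "\<tau> * (x * langevin x - r * x * langevin (r * x))
        > x * langevin (r * x) - r * x * langevin x"
      unfolding \<tau>_def by (rule langevin_tanh_ineq[OF s])
    then have "x * (\<tau> * (langevin x - r * langevin (r * x))) > x * (langevin (r * x) - r * langevin x)"
      by (simp add: algebra_simps)
    then have "\<tau> * (langevin x - r * langevin (r * x)) > langevin (r * x) - r * langevin x"
      using x by simp
    then have "r * (\<tau> * (langevin x - r * langevin (r * x))) > r * (langevin (r * x) - r * langevin x)"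
      using r by simp
    moreover have "(m' x + \<tau> * (r * m' x) - langevin x) * (1 - r\<^sup>2) =
        (langevin x - r * langevin (r * x)) * (1 + r * \<tau>) - langevin x * (1 - r\<^sup>2)"
    proof -
      have "m' x * (1 - r\<^sup>2) = langevin x - r * langevin (r * x)"
        using r2 by (simp add: m'_def)
      then show ?thesis by algebra
    qed
    ultimately have "(m' x + \<tau> * (r * m' x) - langevin x) * (1 - r\<^sup>2) > 0"
      by (simp add: algebra_simps power2_eq_square)
    then show "m' x + tanh (r * m x) * (r * m' x) - langevin x > 0"
      using r2 by (simp add: zero_less_mult_iff \<tau>_def)
  next
    have "filterlim (\<lambda>x. r * x) (at_right 0) (at_right 0)"
      using r unfolding filterlim_at
      by (auto intro!: tendsto_eq_intros simp: eventually_at_right_field intro: exI[of _ 1])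
    then have "((\<lambda>x. ln_sinhc (r * x)) \<longlongrightarrow> 0) (at_right 0)"
      by (rule filterlim_compose[OF ln_sinhc_tendsto])
    then have "(m \<longlongrightarrow> 0) (at_right 0)"
      unfolding m_def using r2 by (auto intro!: tendsto_eq_intros ln_sinhc_tendsto)
    then show "((\<lambda>t. m t + ln (cosh (r * m t)) - ln_sinhc t) \<longlongrightarrow> 0) (at_right 0)"
      by (auto intro!: tendsto_eq_intros ln_sinhc_tendsto)
  qed
  then show ?thesis by simp
qed

lemma ln_sinhc_less:
  assumes "0 < r" "r \<noteq> 1" "t > 0"
  defines "m \<equiv> (ln_sinhc (r * t) - ln_sinhc t) / (r\<^sup>2 - 1)"
  shows "ln_sinhc t < m + ln (cosh (r * m))"
proof (cases "r < 1")
  case True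
  have "m = (ln_sinhc t - ln_sinhc (r * t)) / (1 - r\<^sup>2)"
    unfolding m_def by (metis minus_diff_eq minus_divide_divide)
  then show ?thesis
    using ln_sinhc_less_lt1[OF \<open>0 < r\<close> True \<open>t > 0\<close>] by simp
next
  case False
  then have r: "r > 1" "r\<^sup>2 - 1 > 0"
    using assms by (auto simp: one_less_power)
  \<comment> \<open>This is \<open>m\<close> for the parameters \<open>1 / r\<close> and
    \<open>r * t\<close>. The \<open>cosh\<close> term is unchanged, while both
    \<open>m' - m\<close> and the change of the left side equal
    \<open>ln_sinhc (r * t) - ln_sinhc t\<close>.\<close>
  define m' where "m' = (ln_sinhc (r * t) - ln_sinhc (1 / r * (r * t))) / (1 - (1 / r)\<^sup>2)"
  have m': "m' = r\<^sup>2 * m"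
  proof -
    have "1 - (1 / r)\<^sup>2 = (r\<^sup>2 - 1) / r\<^sup>2"
      using r by (simp add: field_simps)
    then show ?thesis
      using r by (simp add: m'_def m_def)
  qed
  have "ln_sinhc (r * t) < m' + ln (cosh (1 / r * m'))"
    unfolding m'_def using r \<open>t > 0\<close> by (intro ln_sinhc_less_lt1) auto
  moreover have "1 / r * m' = r * m"
    using r by (simp add: m' power2_eq_square)
  moreover have "(r\<^sup>2 - 1) * m = ln_sinhc (r * t) - ln_sinhc t"
    unfolding m_def times_divide_eq_right using r(2) by (intro nonzero_mult_div_cancel_left) linarith
  ultimately show ?thesis
    by (simp add: m' algebra_simps)
qed

text \<open>Here \<open>m t\<close> is the limit of
  \<open>(ln_sinhc (r * t) - ln_sinhc t) / (r\<^sup>2 - 1)\<close> as \<open>r\<close> tends to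
  \<open>1\<close>.\<close>

lemma ln_sinhc_less_eq1:
  assumes "t > 0"
  defines "m \<equiv> \<lambda>t. t * langevin t / 2"
  shows "ln_sinhc t < m t + ln (cosh (m t))"
proof -
  define m' where "m' = (\<lambda>t. (langevin t + t * langevin' t) / 2)"
  have m: "(m has_real_derivative m' x) (at x)" if "x > 0" for x
    unfolding m_def m'_def using that
    by (auto intro!: derivative_eq_intros has_real_derivative_langevin)
  have "0 < m t + ln (cosh (m t)) - ln_sinhc t"
  proof (rule pos_if_tendsto_0_at_right[OF _ _ _ \<open>t > 0\<close>])
    fix x :: real assume x: "x > 0"
    show "((\<lambda>t. m t + ln (cosh (m t)) - ln_sinhc t) has_real_derivative
        m' x + tanh (m x) * m' x - langevin x) (at x)"
      using x by (intro derivative_intros m has_real_derivative_ln_sinhc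
          DERIV_chain2[OF has_real_derivative_ln_cosh])
    have pos: "langevin' x > 0" "langevin x > 0"
      using x langevin'_pos langevin_pos by auto
    have "langevin x < (1 + x * langevin x) * (x * langevin' x)"
    proof -
      \<comment> \<open>Since \<open>1 + x * langevin x\<close> is
        \<open>x * cosh x / sinh x\<close>, the terms \<open>cosh x / sinh x\<close> cancel and
        \<open>sinh_cubed_gt\<close> remains.\<close>
      have "(1 + x * langevin x) * (x * langevin' x) - langevin x
          = 1 / x - x\<^sup>2 * cosh x / sinh x ^ 3"
        unfolding langevin_def langevin'_def using x
        by (simp add: field_simps eval_nat_numeral)
      moreover have "1 / x - x\<^sup>2 * cosh x / sinh x ^ 3 > 0"
        using sinh_cubed_gt[OF x] x by (simp add: field_simps eval_nat_numeral)
      ultimately show ?thesis by linarith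
    qed
    also have "\<dots> \<le> exp (2 * m x) * (x * langevin' x)"
      using pos x exp_ge_add_one_self[of "2 * m x"] by (intro mult_right_mono) (auto simp: m_def)
    finally have "tanh (m x) * (langevin x + x * langevin' x) > langevin x - x * langevin' x"
      using pos x by (intro tanh_real_gt_divide add_pos_pos) (auto simp: algebra_simps)
    then show "m' x + tanh (m x) * m' x - langevin x > 0"
      by (simp add: m'_def field_simps)
  next
    have "((\<lambda>x::real. cosh x) \<longlongrightarrow> 1) (at_right 0)"
      by (auto intro!: tendsto_eq_intros)
    from tendsto_divide[OF this sinhc_tendsto]
    have "((\<lambda>x::real. (cosh x / (sinh x / x) - 1) / 2) \<longlongrightarrow> (1 / 1 - 1) / 2) (at_right 0)"
      by (intro tendsto_divide[of _ _ _ "\<lambda>_. 2"] tendsto_diff tendsto_const) auto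
    then have "((\<lambda>x::real. (cosh x / (sinh x / x) - 1) / 2) \<longlongrightarrow> 0) (at_right 0)"
      by simp
    moreover have "eventually (\<lambda>x. (cosh x / (sinh x / x) - 1) / 2 = m x) (at_right 0)"
      by (auto simp: eventually_at_right_field m_def langevin_def field_simps intro!: exI[of _ 1])
    ultimately have "(m \<longlongrightarrow> 0) (at_right 0)"
      by (rule Lim_transform_eventually)
    then show "((\<lambda>t. m t + ln (cosh (m t)) - ln_sinhc t) \<longlongrightarrow> 0) (at_right 0)"
      by (auto intro!: tendsto_eq_intros ln_sinhc_tendsto)
  qed
  then show ?thesis by simp
qed

text \<open>Exponentiation turns \<open>ln (cosh z)\<close> into a sum of two exponentials, which
  for \<open>z = r * m\<close> are the means of orders \<open>r\<close> and \<open>-r\<close>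
  divided by \<open>exp c\<close>.\<close>

lemma sinhc_less_if_ln_sinhc_less:
  fixes t :: real
  assumes "t > 0" "ln_sinhc t < m + ln (cosh z)"
  shows "2 * (sinh t / t) < exp (m + z) + exp (m - z)"
proof -
  have "sinh t / t = exp (ln_sinhc t)"
    using assms by (simp add: ln_sinhc_def)
  also have "\<dots> < exp (m + ln (cosh z))"
    using assms by simp
  also have "\<dots> = exp m * cosh z"
    by (simp add: exp_add)
  also have "2 * \<dots> = exp (m + z) + exp (m - z)"
    by (simp add: cosh_def exp_add exp_diff exp_minus field_simps)
  finally show ?thesis by simp
qed

section \<open>The means in logarithmic coordinates\<close>

context
  fixes a b c t :: real
  assumes a: "a = exp (c - t)" and b: "b = exp (c + t)" and t: "t > 0"
begin

lemma exp_diff_eq_sinh: "b - a = exp c * (2 * sinh t)"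
  by (simp add: a b sinh_def exp_add exp_diff exp_minus field_simps)

lemma gen_log_mean_real_0_eq: "gen_log_mean_real 0 a b = exp c * (sinh t / t)"
  using t by (simp add: gen_log_mean_real_def exp_diff_eq_sinh) (simp add: a b)

text \<open>The logarithm of the power is \<open>c + t * cosh t / sinh t\<close>, which is
  \<open>c + t * langevin t + 1\<close>; the \<open>1\<close> absorbs the factor
  \<open>1 / exp 1\<close>.\<close>

lemma gen_log_mean_real_1_eq: "gen_log_mean_real 1 a b = exp c * exp (t * langevin t)"
proof -
  have "b * (c + t) - a * (c - t) = exp c * (2 * sinh t) * c + exp c * (2 * cosh t) * t"
    by (simp add: a b sinh_def cosh_def exp_add exp_diff exp_minus field_simps)
  then have "(b * (c + t) - a * (c - t)) / (b - a) = c + t * cosh t / sinh t"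
    using t by (simp add: exp_diff_eq_sinh field_simps)
  also have "\<dots> = c + t * langevin t + 1"
    using t by (simp add: langevin_def field_simps)
  finally have *: "(b * (c + t) - a * (c - t)) / (b - a) = c + t * langevin t + 1" .
  have "b powr b / a powr a = exp (b * (c + t) - a * (c - t))"
    by (simp add: powr_def exp_diff) (simp add: a b)
  then have "(b powr b / a powr a) powr (1 / (b - a)) = exp ((b * (c + t) - a * (c - t)) / (b - a))"
    by (simp add: powr_def)
  also have "\<dots> = exp (c + t * langevin t + 1)"
    by (simp only: *)
  finally show ?thesis
    by (simp add: gen_log_mean_real_def exp_add)
qed

lemma gen_log_mean_real_eq:
  assumes "r \<noteq> 0" "r \<noteq> 1"
  shows "gen_log_mean_real r a b = exp c * exp ((ln_sinhc (r * t) - ln_sinhc t) / (r - 1))"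
proof -
  \<comment> \<open>\<open>r\<close> may be negative; the quotient is positive since
    \<open>sinh\<close> has the sign of its argument.\<close>
  have pos: "sinh (r * t) / (r * t) > 0" "sinh t / t > 0"
    using assms t by (auto simp: zero_less_divide_iff zero_less_mult_iff mult_less_0_iff)
  have "b powr r - a powr r = exp (r * c) * (2 * sinh (r * t))"
    by (simp add: a b powr_def) (simp add: sinh_def exp_add exp_diff exp_minus field_simps)
  then have "(b powr r - a powr r) / (r * (b - a))
      = exp (r * c - c) * ((sinh (r * t) / (r * t)) / (sinh t / t))"
    using assms t by (simp add: exp_diff_eq_sinh exp_diff)
  also have "\<dots> = exp ((r - 1) * c + (ln_sinhc (r * t) - ln_sinhc t))"
    using pos by (simp add: ln_sinhc_def exp_add exp_diff left_diff_distrib)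
  finally have "gen_log_mean_real r a b
      = exp (((r - 1) * c + (ln_sinhc (r * t) - ln_sinhc t)) / (r - 1))"
    using assms by (simp add: gen_log_mean_real_def powr_def)
  then show ?thesis
    using assms by (simp add: add_divide_distrib exp_add)
qed

lemma gen_log_mean_real_add_gt:
  assumes "r > 0"
  shows "gen_log_mean_real r a b + gen_log_mean_real (- r) a b > 2 * gen_log_mean_real 0 a b"
proof -
  have "\<exists>x y. gen_log_mean_real r a b = exp c * x \<and> gen_log_mean_real (- r) a b = exp c * y \<and>
      2 * (sinh t / t) < x + y"
  proof (cases "r = 1")
    case True
    \<comment> \<open>\<open>ln_sinhc\<close> is even, so the exponent vanishes at order
      \<open>-1\<close>, leaving the geometric mean.\<close>
    have "gen_log_mean_real (- 1) a b = exp c * 1"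
      by (simp add: gen_log_mean_real_eq ln_sinhc_def)
    moreover have "2 * (sinh t / t) < exp (t * langevin t) + 1"
      using sinhc_less_if_ln_sinhc_less[OF t ln_sinhc_less_eq1[OF t]] by simp
    ultimately show ?thesis
      using True gen_log_mean_real_1_eq by blast
  next
    case False
    define m where "m = (ln_sinhc (r * t) - ln_sinhc t) / (r\<^sup>2 - 1)"
    have r2: "r\<^sup>2 - 1 = (r - 1) * (r + 1)"
      by (simp add: algebra_simps power2_eq_square)
    have even: "ln_sinhc (- r * t) = ln_sinhc (r * t)"
      by (simp add: ln_sinhc_def)
    have d: "ln_sinhc (r * t) - ln_sinhc t = m * ((r - 1) * (r + 1))"
      using False assms by (simp add: m_def r2)
    have "gen_log_mean_real r a b = exp c * exp (m + r * m)"
      using False assms by (simp add: gen_log_mean_real_eq d) (simp add: algebra_simps)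
    moreover have "m * ((r - 1) * (r + 1)) / (- r - 1) = m - r * m"
      using assms by (simp add: field_simps)
    then have "gen_log_mean_real (- r) a b = exp c * exp (m - r * m)"
      using assms gen_log_mean_real_eq[of "- r"] unfolding even d by simp
    moreover have "2 * (sinh t / t) < exp (m + r * m) + exp (m - r * m)"
      using sinhc_less_if_ln_sinhc_less[OF t ln_sinhc_less[OF assms False t]]
      by (simp add: m_def)
    ultimately show ?thesis by blast
  qed
  then obtain x y where "gen_log_mean_real r a b = exp c * x" "gen_log_mean_real (- r) a b = exp c * y"
    and "2 * (sinh t / t) < x + y"
    by blast
  moreover from this(3) have "exp c * (2 * (sinh t / t)) < exp c * (x + y)"
    by (intro mult_strict_left_mono) auto
  ultimately show ?thesis
    by (simp add: gen_log_mean_real_0_eq distrib_left mult_ac)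
qed

text \<open>This is the case of infinite order, where the two means are \<open>max a b\<close> and
  \<open>min a b\<close>. It amounts to \<open>sinh t / t < cosh t\<close>, that is, to positivity
  of \<open>langevin\<close>.\<close>

lemma log_mean_less_arith_mean: "2 * gen_log_mean_real 0 a b < a + b"
proof -
  have "sinh t / t < cosh t"
    using langevin_pos[OF t] t by (simp add: langevin_def field_simps)
  then have "exp c * (2 * (sinh t / t)) < exp c * (2 * cosh t)"
    by (intro mult_strict_left_mono) auto
  also have "\<dots> = a + b"
    by (simp add: a b cosh_def exp_add exp_diff exp_minus field_simps)
  finally show ?thesis
    by (simp add: gen_log_mean_real_0_eq mult_ac)
qed

end

theorem theorem3p1:
  fixes r :: ereal and a b :: real
  assumes "0 < r" and "0 < a" and "a < b"
  shows "gen_log_mean r a b + gen_log_mean (- r) a b > 2 * gen_log_mean 0 a b"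
proof -
  \<comment> \<open>\<open>exp c\<close> is the geometric mean of \<open>a\<close> and
    \<open>b\<close>, and \<open>t\<close> is half of \<open>ln (b / a)\<close>.\<close>
  define c t where "c = (ln b + ln a) / 2" and "t = (ln b - ln a) / 2"
  have "c - t = ln a" "c + t = ln b"
    by (simp_all add: c_def t_def field_simps)
  then have ab: "a = exp (c - t)" "b = exp (c + t)"
    using assms by auto
  have t: "t > 0"
    using assms by (simp add: t_def)
  show ?thesis
  proof (cases r)
    case (real x)
    then show ?thesis
      using gen_log_mean_real_add_gt[OF ab t, of x] \<open>0 < r\<close> by (simp add: gen_log_mean_def)
  next
    case PInf
    then show ?thesis
      using log_mean_less_arith_mean[OF ab t] assms by (simp add: gen_log_mean_def)
  next
    case MInf
    then show ?thesis
      using \<open>0 < r\<close> by simp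
  qed
qed

end
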